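(* Let $m\ge3$ be an integer and let $1\le j\le\frac{m+2}{2}$ be a fixed integer. Then, as functions of $a=(a_1,\dots,a_{m-1})\in\mathbb{C}^{m-1}$: (i) $d_j(a)$ and $e_j(a)$ are polynomials in $a_1,a_2,\dots,a_{j-1},a_j$. In particular, $d_j(a)$ and $e_j(a)$ are nonconstant linear functions of $a_j$ (i.e. polynomials of degree exactly one in $a_j$). (ii) $d_j(a)$ and $e_j(a)$ do not depend on $a_{j+1},a_{j+2},\dots,a_{m-1}$.
   Context: Multi-indices. $\xi=(\xi_1,\dots,\xi_{m-1})\in(\mathbb{N}\cup\{0\})^{m-1}$, $\eta=(1,2,\dots,m-1)$, $|\xi|=\xi_1+\cdots+\xi_{m-1}$, $\xi!=\xi_1!\cdots\xi_{m-1}!$, $a^\xi=a_1^{\xi_1}\cdots a_{m-1}^{\xi_{m-1}}$ (similarly $e(a)^\xi$), $\xi\cdot\eta=\sum_j j\xi_j$; $\binom{s}{k}$ is the generalized binomial coefficient. Definition of $d_j$. $b_{j,k}(a)=\binom{1/2}{k}\sum_{|\xi|=k,\ \xi\cdot\eta=j}\frac{k!}{\xi!}a^\xi$ for $1\le k\le j\le\frac{m+2}{2}$. $K_{m,0}(a)=\frac{B(\frac12,1+\frac1m)}{2\cos(\pi/m)}$ ($B$ the beta function), $K_{m,j}(a)=\sum_{k=1}^j b_{j,k}(a)K_{m,j,k}$ for $1\le j\le\frac{m+1}{2}$, where $K_{m,j,k}=\int_0^\infty\left(\frac{t^{mk-j}}{(t^m+1)^{k-1/2}}-t^{\frac m2-j}\right)dt$.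 $\nu(a)=\sum_{k=1}^{\frac m2+1}b_{\frac m2+1,k}(a)$ if $m$ is even, $\nu(a)=0$ if $m$ is odd. Then $d_j(a)=\cos\left(\frac{(j-1)\pi}{m}\right)K_{m,j}(a)$ if $0\le j\le\frac{m+1}{2}$, and $d_j(a)=-\frac{\nu(a)}{m}\pi$ if $m$ is even and $j=\frac{m+2}{2}$. Definition of $e_j$. $e_0(a)=1$ and, recurrently for $1\le j\le\frac{m+2}{2}$, $$e_j(a)=-\frac{2m}{m+2}\left(\frac{d_j(a)}{d_0(a)}+\sum_{\substack{|\xi|=k\ge2\\ \xi\cdot\eta=j}}\binom{\frac12+\frac1m}{k}\frac{k!}{\xi!}e(a)^\xi+\sum_{r=1}^{j-1}\frac{d_r(a)}{d_0(a)}\sum_{\substack{|\xi|=k\\ \xi\cdot\eta=j-r}}\binom{\frac12+\frac{1-r}{m}}{k}\frac{k!}{\xi!}e(a)^\xi\right),$$ where $e(a)=(e_1(a),\dots,e_{m-1}(a))$, the inner sums run over all multi-indices $\xi$ (with $k:=|\xi|$) satisfying the constraints, and only entries $e_\ell(a)$ with $\ell<j$ occur on the right. *)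

theory Defs
  imports "HOL-Analysis.Analysis" "HOL-Computational_Algebra.Polynomial"
begin

text \<open>
  A point \<open>a = (a\<^sub>1, \<dots>, a\<^sub>m\<^sub>-\<^sub>1)\<close> of complex \<open>(m-1)\<close>-space is a function of type
  \<open>nat \<Rightarrow> complex\<close> of which only the values at \<open>1, \<dots>, m-1\<close> are ever used. A multi-index
  \<open>\<xi>\<close> is a function of type \<open>nat \<Rightarrow> nat\<close> that vanishes outside \<open>{1..m-1}\<close>; this makes
  it unique, so that sums over multi-indices count each of them once.
\<close>

definition multi_indices :: "nat \<Rightarrow> (nat \<Rightarrow> nat) set" where
  "multi_indices m = {\<xi>. \<forall>i. i \<notin> {1..m-1} \<longrightarrow> \<xi> i = 0}"

definition mi_abs :: "nat \<Rightarrow> (nat \<Rightarrow> nat) \<Rightarrow> nat" where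
  "mi_abs m \<xi> = (\<Sum>i=1..m-1. \<xi> i)"

definition mi_weight :: "nat \<Rightarrow> (nat \<Rightarrow> nat) \<Rightarrow> nat" where
  "mi_weight m \<xi> = (\<Sum>i=1..m-1. i * \<xi> i)"

definition mi_fact :: "nat \<Rightarrow> (nat \<Rightarrow> nat) \<Rightarrow> complex" where
  "mi_fact m \<xi> = (\<Prod>i=1..m-1. fact (\<xi> i))"

definition mi_power :: "nat \<Rightarrow> (nat \<Rightarrow> complex) \<Rightarrow> (nat \<Rightarrow> nat) \<Rightarrow> complex" where
  "mi_power m a \<xi> = (\<Prod>i=1..m-1. a i ^ \<xi> i)"

lemma mi_weight_ge:
  assumes "\<xi> \<in> multi_indices m"
  shows "i * \<xi> i \<le> mi_weight m \<xi>"
proof (cases "i \<in> {1..m-1}")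
  case True
  then show ?thesis
    unfolding mi_weight_def by (intro member_le_sum) auto
next
  case False
  then show ?thesis using assms by (auto simp: multi_indices_def)
qed

text \<open>The index sets of all sums below are finite, so no sum takes the default value 0.\<close>

lemma finite_multi_indices_weight: "finite {\<xi> \<in> multi_indices m. mi_weight m \<xi> = s}"
proof (rule finite_subset)
  show "{\<xi> \<in> multi_indices m. mi_weight m \<xi> = s}
      \<subseteq> {\<xi>. \<forall>i. (i \<in> {1..m-1} \<longrightarrow> \<xi> i \<in> {..s}) \<and> (i \<notin> {1..m-1} \<longrightarrow> \<xi> i = 0)}"
  proof (intro subsetI CollectI allI conjI impI)
    fix \<xi> i assume \<xi>: "\<xi> \<in> {\<xi> \<in> multi_indices m. mi_weight m \<xi> = s}"
    { assume "i \<in> {1..m-1}"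
      then have "\<xi> i \<le> i * \<xi> i" by simp
      also have "\<dots> \<le> s" using mi_weight_ge[of \<xi> m i] \<xi> by simp
      finally show "\<xi> i \<in> {..s}" by simp }
    { assume "i \<notin> {1..m-1}"
      then show "\<xi> i = 0" using \<xi> by (auto simp: multi_indices_def) }
  qed
  show "finite {\<xi>. \<forall>i. (i \<in> {1..m-1} \<longrightarrow> \<xi> i \<in> {..s}) \<and> (i \<notin> {1..m-1} \<longrightarrow> \<xi> i = (0::nat))}"
    by (rule finite_set_of_finite_funs) auto
qed

definition b_coeff :: "nat \<Rightarrow> nat \<Rightarrow> nat \<Rightarrow> (nat \<Rightarrow> complex) \<Rightarrow> complex" where
  "b_coeff m j k a =
     ((1/2) gchoose k) *
     (\<Sum>\<xi> | \<xi> \<in> multi_indices m \<and> mi_abs m \<xi> = k \<and> mi_weight m \<xi> = j.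
        fact k / mi_fact m \<xi> * mi_power m a \<xi>)"

definition K_integral :: "nat \<Rightarrow> nat \<Rightarrow> nat \<Rightarrow> real" where
  "K_integral m j k =
     (LBINT t:{0<..}. t powr (real m * real k - real j) / (t ^ m + 1) powr (real k - 1/2)
                      - t powr (real m / 2 - real j))"

definition K_coeff :: "nat \<Rightarrow> nat \<Rightarrow> (nat \<Rightarrow> complex) \<Rightarrow> complex" where
  "K_coeff m j a =
     (if j = 0 then complex_of_real (Beta (1/2) (1 + 1 / real m) / (2 * cos (pi / real m)))
      else (\<Sum>k=1..j. b_coeff m j k a * complex_of_real (K_integral m j k)))"

definition nu :: "nat \<Rightarrow> (nat \<Rightarrow> complex) \<Rightarrow> complex" where
  "nu m a = (if even m then (\<Sum>k=1..m div 2 + 1. b_coeff m (m div 2 + 1) k a) else 0)"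

text \<open>
  The coefficients \<open>d\<^sub>j\<close> and \<open>e\<^sub>j\<close> are meaningful for \<open>j \<le> (m+2)/2\<close> only; the value 0 of
  \<open>d_coeff\<close> beyond this range is arbitrary.
\<close>

definition d_coeff :: "nat \<Rightarrow> nat \<Rightarrow> (nat \<Rightarrow> complex) \<Rightarrow> complex" where
  "d_coeff m j a =
     (if real j \<le> (real m + 1) / 2
        then complex_of_real (cos ((real j - 1) * pi / real m)) * K_coeff m j a
      else if even m \<and> real j = (real m + 2) / 2
        then - (nu m a / of_nat m) * complex_of_real pi
      else 0)"

text \<open>
  The guard \<open>l < j\<close> only serves the termination proof: all multi-indices on the right-hand side
  vanish at every \<open>l \<ge> j\<close>, so that the default \<open>0\<close> contributes the factor \<open>0 ^ 0 = 1\<close>.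
  Lemma \<open>e_coeff_rec\<close> is the recurrence without it.
\<close>

function e_coeff :: "nat \<Rightarrow> nat \<Rightarrow> (nat \<Rightarrow> complex) \<Rightarrow> complex" where
  "e_coeff m j a =
     (if j = 0 then 1 else
      - (2 * of_nat m / (of_nat m + 2)) *
      (d_coeff m j a / d_coeff m 0 a
       + (\<Sum>\<xi> | \<xi> \<in> multi_indices m \<and> 2 \<le> mi_abs m \<xi> \<and> mi_weight m \<xi> = j.
            ((1/2 + 1 / of_nat m) gchoose mi_abs m \<xi>) * (fact (mi_abs m \<xi>) / mi_fact m \<xi>)
            * mi_power m (\<lambda>l. if l < j then e_coeff m l a else 0) \<xi>)
       + (\<Sum>r=1..j-1. d_coeff m r a / d_coeff m 0 a *
            (\<Sum>\<xi> | \<xi> \<in> multi_indices m \<and> mi_weight m \<xi> = j - r.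
               ((1/2 + (1 - of_nat r) / of_nat m) gchoose mi_abs m \<xi>)
               * (fact (mi_abs m \<xi>) / mi_fact m \<xi>)
               * mi_power m (\<lambda>l. if l < j then e_coeff m l a else 0) \<xi>))))"
  by auto
termination by (relation "Wellfounded.measure (\<lambda>(m, j, a). j)") auto

declare e_coeff.simps [simp del]

lemma e_coeff_0: "e_coeff m 0 a = 1"
  by (simp add: e_coeff.simps)

lemma mi_power_guard:
  assumes "\<xi> \<in> multi_indices m" "mi_weight m \<xi> < j \<or> mi_weight m \<xi> = j \<and> 2 \<le> mi_abs m \<xi>"
  shows "mi_power m (\<lambda>l. if l < j then f l else 0) \<xi> = mi_power m f \<xi>"
  unfolding mi_power_def
proof (rule prod.cong)
  fix l assume l: "l \<in> {1..m-1}"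
  show "(if l < j then f l else 0) ^ \<xi> l = f l ^ \<xi> l"
  proof (cases "l < j")
    case False
    have "\<xi> l = 0"
    proof (rule ccontr)
      assume nz: "\<xi> l \<noteq> 0"
      have le: "mi_weight m \<xi> \<le> l"
        using assms(2) False by auto
      have split: "mi_weight m \<xi> = l * \<xi> l + (\<Sum>i\<in>{1..m-1}-{l}. i * \<xi> i)"
        unfolding mi_weight_def using l by (subst sum.remove[of _ l]) auto
      have "l * 1 \<le> l * \<xi> l" using nz by (intro mult_le_mono2) simp
      then have eq: "mi_weight m \<xi> = l" "l * \<xi> l = l" "(\<Sum>i\<in>{1..m-1}-{l}. i * \<xi> i) = 0"
        using le split by linarith+
      have "\<xi> l = 1" using eq(2) l by simp
      moreover have "(\<Sum>i\<in>{1..m-1}-{l}. \<xi> i) = 0"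
        using eq(3) by (intro sum.neutral) auto
      ultimately have "mi_abs m \<xi> = 1"
        unfolding mi_abs_def using l by (subst sum.remove[of _ l]) auto
      then show False using assms(2) eq(1) False by auto
    qed
    then show ?thesis by simp
  qed simp
qed simp

lemma e_coeff_rec:
  assumes "1 \<le> j"
  shows "e_coeff m j a =
      - (2 * of_nat m / (of_nat m + 2)) *
      (d_coeff m j a / d_coeff m 0 a
       + (\<Sum>\<xi> | \<xi> \<in> multi_indices m \<and> 2 \<le> mi_abs m \<xi> \<and> mi_weight m \<xi> = j.
            ((1/2 + 1 / of_nat m) gchoose mi_abs m \<xi>) * (fact (mi_abs m \<xi>) / mi_fact m \<xi>)
            * mi_power m (\<lambda>l. e_coeff m l a) \<xi>)
       + (\<Sum>r=1..j-1. d_coeff m r a / d_coeff m 0 a *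
            (\<Sum>\<xi> | \<xi> \<in> multi_indices m \<and> mi_weight m \<xi> = j - r.
               ((1/2 + (1 - of_nat r) / of_nat m) gchoose mi_abs m \<xi>)
               * (fact (mi_abs m \<xi>) / mi_fact m \<xi>)
               * mi_power m (\<lambda>l. e_coeff m l a) \<xi>)))"
proof -
  have nz: "(j = 0) = False" using assms by simp
  show ?thesis
    by (subst e_coeff.simps, unfold nz if_False)
       (intro arg_cong2[of _ _ _ _ "(*)"] arg_cong2[of _ _ _ _ "(+)"] refl sum.cong
              mi_power_guard; auto)
qed

text \<open>\<open>f\<close> is a polynomial in the variables \<open>a\<^sub>i\<close>, \<open>i \<in> I\<close>, with complex coefficients.\<close>

definition polynomial_in :: "nat set \<Rightarrow> ((nat \<Rightarrow> complex) \<Rightarrow> complex) \<Rightarrow> bool" where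
  "polynomial_in I f \<longleftrightarrow>
     (\<exists>S c. finite S \<and> (\<forall>\<xi>\<in>S. \<forall>i. i \<notin> I \<longrightarrow> \<xi> i = (0::nat)) \<and>
        (\<forall>a. f a = (\<Sum>\<xi>\<in>S. c \<xi> * (\<Prod>i\<in>I. a i ^ \<xi> i))))"

text \<open>
  For every choice of the other variables, \<open>f\<close> is a polynomial of degree exactly one in \<open>a\<^sub>j\<close>.
\<close>

definition nonconstant_linear_in :: "nat \<Rightarrow> ((nat \<Rightarrow> complex) \<Rightarrow> complex) \<Rightarrow> bool" where
  "nonconstant_linear_in j f \<longleftrightarrow>
     (\<forall>a. \<exists>p :: complex poly. degree p = 1 \<and> (\<forall>z. f (a(j := z)) = poly p z))"

definition independent_of :: "nat set \<Rightarrow> ((nat \<Rightarrow> complex) \<Rightarrow> complex) \<Rightarrow> bool" where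
  "independent_of I f \<longleftrightarrow> (\<forall>a a'. (\<forall>i. i \<notin> I \<longrightarrow> a i = a' i) \<longrightarrow> f a = f a')"

end

theory Submission
  imports Defs
begin

text \<open>
  A multi-index of weight \<open>j\<close> that does not vanish at \<open>j\<close> is the unit vector at \<open>j\<close>. Hence
  \<open>a\<^sub>j\<close> enters \<open>d\<^sub>j\<close> only through \<open>b\<^sub>j\<^sub>,\<^sub>1 = a\<^sub>j / 2\<close>, and \<open>e\<^sub>j\<close> only through
  the term \<open>d\<^sub>j / d\<^sub>0\<close>; everything else is a polynomial in the earlier variables. For
  \<open>j \<le> (m+1)/2\<close> the coefficient of \<open>a\<^sub>j\<close> is nonzero because the integrand of
  \<open>K\<^sub>m\<^sub>,\<^sub>j\<^sub>,\<^sub>1\<close> is negative everywhere and integrable, being bounded by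
  \<open>t\<close> to the \<open>m/2 - j > -1\<close> near \<open>0\<close> and \<open>t\<close> to the \<open>-m/2 - j < -1\<close> near infinity.
\<close>

section \<open>Closure properties of polynomials in a set of variables\<close>

text \<open>Different \<open>x\<close> may share an exponent vector \<open>\<phi> x\<close>;
  collecting like terms, that is, summing \<open>c\<close> over each fibre of \<open>\<phi>\<close>,
  restores the form demanded by \<open>polynomial_in\<close>. This permits index sets of any type
  below: a disjoint union for sums, a Cartesian product for products.\<close>

lemma polynomial_in_reindex:
  assumes "finite X" and "\<And>x i. x \<in> X \<Longrightarrow> i \<notin> I \<Longrightarrow> \<phi> x i = 0"
    and "\<And>a. f a = (\<Sum>x\<in>X. c x * (\<Prod>i\<in>I. a i ^ \<phi> x i))"
  shows "polynomial_in I f"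
  unfolding polynomial_in_def
proof (intro exI conjI allI ballI impI)
  show "finite (\<phi> ` X)" using assms(1) by simp
  show "\<xi> i = 0" if "\<xi> \<in> \<phi> ` X" "i \<notin> I" for \<xi> i
    using that assms(2) by auto
  fix a
  have "f a = (\<Sum>\<xi>\<in>\<phi> ` X. \<Sum>x | x \<in> X \<and> \<phi> x = \<xi>. c x * (\<Prod>i\<in>I. a i ^ \<phi> x i))"
    unfolding assms(3) by (rule sum.image_gen[OF assms(1)])
  also have "\<dots> = (\<Sum>\<xi>\<in>\<phi> ` X. (\<Sum>x | x \<in> X \<and> \<phi> x = \<xi>. c x) * (\<Prod>i\<in>I. a i ^ \<xi> i))"
    by (intro sum.cong) (auto simp: sum_distrib_right)
  finally show "f a = \<dots>" .
qed

lemma polynomial_in_const [intro]: "polynomial_in I (\<lambda>_. z)"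
  by (rule polynomial_in_reindex[where X = "{()}" and \<phi> = "\<lambda>_ _. 0" and c = "\<lambda>_. z"]) auto

lemma polynomial_in_var:
  assumes "finite I" "i \<in> I"
  shows "polynomial_in I (\<lambda>a. a i)"
proof (rule polynomial_in_reindex[where X = "{()}" and \<phi> = "\<lambda>_ l. if l = i then 1 else 0"
      and c = "\<lambda>_. 1"])
  fix a :: "nat \<Rightarrow> complex"
  have "(\<Prod>l\<in>I. a l ^ (if l = i then 1 else 0)) = (\<Prod>l\<in>I. if l = i then a l else 1)"
    by (intro prod.cong) auto
  then show "a i = (\<Sum>x\<in>{()}. 1 * (\<Prod>l\<in>I. a l ^ (if l = i then 1 else 0)))"
    using assms by simp
qed (use assms in auto)

lemma polynomial_in_add [intro]:
  assumes "polynomial_in I f" "polynomial_in I g"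
  shows "polynomial_in I (\<lambda>a. f a + g a)"
proof -
  obtain S c where S: "finite S" "\<And>\<xi> i. \<xi> \<in> S \<Longrightarrow> i \<notin> I \<Longrightarrow> \<xi> i = 0"
    "\<And>a. f a = (\<Sum>\<xi>\<in>S. c \<xi> * (\<Prod>i\<in>I. a i ^ \<xi> i))"
    using assms(1) unfolding polynomial_in_def by blast
  obtain T d where T: "finite T" "\<And>\<xi> i. \<xi> \<in> T \<Longrightarrow> i \<notin> I \<Longrightarrow> \<xi> i = 0"
    "\<And>a. g a = (\<Sum>\<xi>\<in>T. d \<xi> * (\<Prod>i\<in>I. a i ^ \<xi> i))"
    using assms(2) unfolding polynomial_in_def by blast
  show ?thesis
  proof (rule polynomial_in_reindex[where X = "S <+> T" and \<phi> = "case_sum id id"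
        and c = "case_sum c d"])
    fix a show "f a + g a =
        (\<Sum>x\<in>S <+> T. case_sum c d x * (\<Prod>i\<in>I. a i ^ case_sum id id x i))"
      using S(1) T(1) by (simp add: sum.Plus S(3) T(3))
  qed (use S T in auto)
qed

lemma polynomial_in_mult [intro]:
  assumes "polynomial_in I f" "polynomial_in I g"
  shows "polynomial_in I (\<lambda>a. f a * g a)"
proof -
  obtain S c where S: "finite S" "\<And>\<xi> i. \<xi> \<in> S \<Longrightarrow> i \<notin> I \<Longrightarrow> \<xi> i = 0"
    "\<And>a. f a = (\<Sum>\<xi>\<in>S. c \<xi> * (\<Prod>i\<in>I. a i ^ \<xi> i))"
    using assms(1) unfolding polynomial_in_def by blast
  obtain T d where T: "finite T" "\<And>\<xi> i. \<xi> \<in> T \<Longrightarrow> i \<notin> I \<Longrightarrow> \<xi> i = 0"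
    "\<And>a. g a = (\<Sum>\<xi>\<in>T. d \<xi> * (\<Prod>i\<in>I. a i ^ \<xi> i))"
    using assms(2) unfolding polynomial_in_def by blast
  show ?thesis
  proof (rule polynomial_in_reindex[where X = "S \<times> T" and \<phi> = "\<lambda>(\<xi>, \<zeta>) i. \<xi> i + \<zeta> i"
        and c = "\<lambda>(\<xi>, \<zeta>). c \<xi> * d \<zeta>"])
    fix a show "f a * g a = (\<Sum>x\<in>S \<times> T. (case x of (\<xi>, \<zeta>) \<Rightarrow> c \<xi> * d \<zeta>) *
        (\<Prod>i\<in>I. a i ^ (case x of (\<xi>, \<zeta>) \<Rightarrow> \<lambda>i. \<xi> i + \<zeta> i) i))"
      unfolding S(3) T(3) sum_product sum.cartesian_product
      by (intro sum.cong) (auto simp: power_add prod.distrib)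
  qed (use S T in auto)
qed

lemma polynomial_in_power [intro]: "polynomial_in I f \<Longrightarrow> polynomial_in I (\<lambda>a. f a ^ n)"
  by (induction n) auto

lemma polynomial_in_divide_const [intro]: "polynomial_in I f \<Longrightarrow> polynomial_in I (\<lambda>a. f a / z)"
  unfolding divide_inverse by auto

lemma polynomial_in_sum:
  "(\<And>x. x \<in> A \<Longrightarrow> polynomial_in I (f x)) \<Longrightarrow> polynomial_in I (\<lambda>a. \<Sum>x\<in>A. f x a)"
  by (induction A rule: infinite_finite_induct) auto

lemma polynomial_in_prod:
  "(\<And>x. x \<in> A \<Longrightarrow> polynomial_in I (f x)) \<Longrightarrow> polynomial_in I (\<lambda>a. \<Prod>x\<in>A. f x a)"
  by (induction A rule: infinite_finite_induct) auto

text \<open>The exponents vanish outside \<open>I\<close>, so the additional factors are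
  \<open>a i ^ 0 = 1\<close>. Finiteness of \<open>J\<close> matters because a product over an
  infinite set is 1 by default.\<close>

lemma polynomial_in_mono:
  assumes "polynomial_in I f" "I \<subseteq> J" "finite J"
  shows "polynomial_in J f"
proof -
  obtain S c where S: "finite S" "\<And>\<xi> i. \<xi> \<in> S \<Longrightarrow> i \<notin> I \<Longrightarrow> \<xi> i = 0"
    "\<And>a. f a = (\<Sum>\<xi>\<in>S. c \<xi> * (\<Prod>i\<in>I. a i ^ \<xi> i))"
    using assms(1) unfolding polynomial_in_def by blast
  have "(\<Prod>i\<in>I. a i ^ \<xi> i) = (\<Prod>i\<in>J. a i ^ \<xi> i)" if "\<xi> \<in> S" for \<xi> and a :: "nat \<Rightarrow> complex"
    using assms(2,3) S(2)[OF that] by (intro prod.mono_neutral_left) auto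
  then have "f a = (\<Sum>\<xi>\<in>S. c \<xi> * (\<Prod>i\<in>J. a i ^ \<xi> i))" for a
    unfolding S(3) by (intro sum.cong) auto
  then show ?thesis
    using S(1,2) assms(2)
    by (intro polynomial_in_reindex[where X = S and \<phi> = "\<lambda>\<xi>. \<xi>" and c = c]) blast+
qed

lemma polynomial_in_cong:
  assumes "polynomial_in I f" "\<And>i. i \<in> I \<Longrightarrow> a i = a' i"
  shows "f a = f a'"
proof -
  obtain S c where "\<And>a. f a = (\<Sum>\<xi>\<in>S. c \<xi> * (\<Prod>i\<in>I. a i ^ \<xi> i))"
    using assms(1) unfolding polynomial_in_def by blast
  then show ?thesis using assms(2) by simp
qed

lemma polynomial_in_imp_independent_of:
  assumes "polynomial_in I f" "I \<inter> J = {}"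
  shows "independent_of J f"
  unfolding independent_of_def using assms by (blast intro: polynomial_in_cong)

section \<open>Functions that are affine in the last variable\<close>

text \<open>A common strengthening of all the claims for \<open>j \<ge> 1\<close>: the coefficient
  of \<open>a j\<close> is a single nonzero constant, not merely a function of the other variables
  that never vanishes, and the remainder involves earlier variables only.\<close>

definition linear_in_last :: "nat \<Rightarrow> ((nat \<Rightarrow> complex) \<Rightarrow> complex) \<Rightarrow> bool" where
  "linear_in_last j f \<longleftrightarrow>
     (\<exists>\<alpha> g. \<alpha> \<noteq> 0 \<and> polynomial_in {1..<j} g \<and> (\<forall>a. f a = \<alpha> * a j + g a))"

lemma linear_in_last_polynomial_in:
  assumes "linear_in_last j f" "1 \<le> j"
  shows "polynomial_in {1..j} f"
proof -
  obtain \<alpha> g where g: "polynomial_in {1..<j} g" and f: "f = (\<lambda>a. \<alpha> * a j + g a)"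
    using assms(1) unfolding linear_in_last_def by blast
  have "polynomial_in {1..j} g" by (rule polynomial_in_mono[OF g]) auto
  then show ?thesis
    unfolding f using assms(2)
    by (intro polynomial_in_add polynomial_in_mult polynomial_in_const polynomial_in_var) auto
qed

lemma linear_in_last_nonconstant_linear_in:
  assumes "linear_in_last j f"
  shows "nonconstant_linear_in j f"
  unfolding nonconstant_linear_in_def
proof
  fix a
  obtain \<alpha> g where g: "\<alpha> \<noteq> 0" "polynomial_in {1..<j} g" and f: "\<And>a. f a = \<alpha> * a j + g a"
    using assms unfolding linear_in_last_def by blast
  have "g (a(j := z)) = g a" for z
    by (rule polynomial_in_cong[OF g(2)]) auto
  then have "degree [:g a, \<alpha>:] = 1 \<and> (\<forall>z. f (a(j := z)) = poly [:g a, \<alpha>:] z)"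
    using g(1) by (simp add: f)
  then show "\<exists>p. degree p = 1 \<and> (\<forall>z. f (a(j := z)) = poly p z)" by blast
qed

text \<open>This is how the property passes from the sums of \<open>b_coeff\<close> to
  \<open>d_coeff\<close>, and from \<open>d_coeff\<close> to \<open>e_coeff\<close>.\<close>

lemma linear_in_last_scale_add:
  assumes "linear_in_last j f" "polynomial_in {1..<j} g" "\<beta> \<noteq> 0"
  shows "linear_in_last j (\<lambda>a. \<beta> * f a + g a)"
proof -
  obtain \<alpha> h where h: "\<alpha> \<noteq> 0" "polynomial_in {1..<j} h" and f: "\<And>a. f a = \<alpha> * a j + h a"
    using assms(1) unfolding linear_in_last_def by blast
  have "polynomial_in {1..<j} (\<lambda>a. \<beta> * h a + g a)" 
    by (intro polynomial_in_add polynomial_in_mult polynomial_in_const h(2) assms(2))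
  then show ?thesis
    unfolding linear_in_last_def using h(1) assms(3)
    by (intro exI[of _ "\<beta> * \<alpha>"] exI[of _ "\<lambda>a. \<beta> * h a + g a"]) (simp add: f algebra_simps)
qed

section \<open>The dependence of the coefficients b_{j,k} on the variables\<close>

lemma polynomial_in_mi_power:
  assumes "\<And>l. l \<in> {1..m-1} \<Longrightarrow> polynomial_in I (f l)"
  shows "polynomial_in I (\<lambda>a. mi_power m (\<lambda>l. f l a) \<xi>)"
  unfolding mi_power_def using assms by (intro polynomial_in_prod polynomial_in_power)

text \<open>Since \<open>k \<ge> 2\<close>, every multi-index in the sum vanishes from
  \<open>j\<close> on. Thus \<open>mi_power_guard\<close>, applied to the point \<open>a\<close>
  itself, allows the variables from \<open>j\<close> on to be replaced by 0.\<close>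

lemma polynomial_in_b_coeff:
  assumes "2 \<le> k"
  shows "polynomial_in {1..<j} (b_coeff m j k)"
proof -
  have "polynomial_in {1..<j} (\<lambda>a. mi_power m a \<xi>)"
    if "\<xi> \<in> multi_indices m" "mi_abs m \<xi> = k" "mi_weight m \<xi> = j" for \<xi>
  proof -
    have "polynomial_in {1..<j} (\<lambda>a. mi_power m (\<lambda>l. if l < j then a l else 0) \<xi>)"
    proof (rule polynomial_in_mi_power)
      fix l assume "l \<in> {1..m-1}"
      then show "polynomial_in {1..<j} (\<lambda>a. if l < j then a l else 0)"
        by (cases "l < j") (auto intro: polynomial_in_var)
    qed
    moreover have "mi_power m (\<lambda>l. if l < j then a l else 0) \<xi> = mi_power m a \<xi>" for a
      using that assms by (intro mi_power_guard) auto
    ultimately show ?thesis by simp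
  qed
  then show ?thesis
    unfolding b_coeff_def[abs_def] by (intro polynomial_in_mult polynomial_in_const polynomial_in_sum) auto
qed

text \<open>Only the unit vector \<open>u\<close> at \<open>j\<close> has length 1 and weight
  \<open>j\<close>, and it is a multi-index because \<open>j \<le> m - 1\<close>. The factor 1/2 is
  the binomial coefficient of 1/2 over 1.\<close>

lemma b_coeff_1:
  assumes "1 \<le> j" "j \<le> m - 1"
  shows "b_coeff m j 1 a = a j / 2"
proof -
  define u :: "nat \<Rightarrow> nat" where "u = (\<lambda>i. if i = j then 1 else 0)"
  have j: "j \<in> {1..m-1}" using assms by auto
  have "\<xi> = u" if \<xi>: "\<xi> \<in> multi_indices m" "mi_abs m \<xi> = 1" "mi_weight m \<xi> = j" for \<xi>
  proof -
    obtain l where l: "l \<in> {1..m-1}" "\<xi> l = 1" "\<forall>i\<in>{1..m-1}. i \<noteq> l \<longrightarrow> \<xi> i = 0"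
      using \<xi>(2) unfolding mi_abs_def
      by (subst (asm) sum_eq_1_iff) (auto simp del: One_nat_def)
    have "mi_weight m \<xi> = (\<Sum>i=1..m-1. if i = l then l else 0)"
      unfolding mi_weight_def using l by (intro sum.cong) auto
    then have "l = j" using l \<xi>(3) by simp
    then show ?thesis
      using l \<xi>(1) unfolding u_def multi_indices_def by fastforce
  qed
  moreover have "u \<in> multi_indices m" using j by (auto simp: u_def multi_indices_def)
  moreover have "mi_abs m u = 1" using j by (simp add: mi_abs_def u_def)
  moreover have "mi_weight m u = j"
  proof -
    have "mi_weight m u = (\<Sum>i=1..m-1. if i = j then j else 0)"
      unfolding mi_weight_def u_def by (intro sum.cong) auto
    then show ?thesis using j by simp
  qed
  ultimately have "{\<xi>. \<xi> \<in> multi_indices m \<and> mi_abs m \<xi> = 1 \<and> mi_weight m \<xi> = j} = {u}"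
    by blast
  moreover have "mi_fact m u = 1"
    unfolding mi_fact_def u_def by (intro prod.neutral) auto
  moreover have "mi_power m a u = a j"
  proof -
    have "mi_power m a u = (\<Prod>i=1..m-1. if i = j then a j else 1)"
      unfolding mi_power_def u_def by (intro prod.cong) auto
    then show ?thesis using j by simp
  qed
  ultimately show ?thesis by (simp add: b_coeff_def)
qed

text \<open>The weights \<open>c\<close> are left arbitrary to cover both branches of
  \<open>d_coeff\<close>: the integrals \<open>K_integral m j k\<close> for \<open>K_coeff\<close>,
  and the constant 1 for \<open>nu\<close>.\<close>

lemma linear_in_last_sum_b_coeff:
  assumes "1 \<le> j" "j \<le> m - 1" "c 1 \<noteq> 0"
  shows "linear_in_last j (\<lambda>a. \<Sum>k=1..j. b_coeff m j k a * c k)"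
proof -
  have "polynomial_in {1..<j} (\<lambda>a. \<Sum>k=2..j. b_coeff m j k a * c k)"
    by (intro polynomial_in_sum polynomial_in_mult polynomial_in_const polynomial_in_b_coeff) auto
  moreover have "(\<Sum>k=1..j. b_coeff m j k a * c k) =
      c 1 / 2 * a j + (\<Sum>k=2..j. b_coeff m j k a * c k)" for a
    using assms(1) b_coeff_1[OF assms(1,2), of a]
    by (simp add: sum.atLeast_Suc_atMost numeral_2_eq_2)
  ultimately show ?thesis
    unfolding linear_in_last_def using assms(3)
    by (intro exI[of _ "c 1 / 2"] exI[of _ "\<lambda>a. \<Sum>k=2..j. b_coeff m j k a * c k"]) simp
qed

section \<open>Nonvanishing of the integral K_{m,j,1}\<close>

text \<open>The first term contains the second as a factor, because the exponents differ by m/2. The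
  factored form shows the sign, and the bracket supplies the decay at infinity.\<close>

lemma K_integral_1_integrand:
  fixes t :: real
  assumes "0 < t"
  shows "t powr (real m - real j) / (t ^ m + 1) powr (1/2) - t powr (real m / 2 - real j)
         = - (t powr (real m / 2 - real j) * (1 - sqrt (t ^ m / (t ^ m + 1))))"
proof -
  have "t powr (real m - real j) = t powr (real m / 2 - real j) * t powr (real m / 2)"
    by (simp flip: powr_add)
  also have "t powr (real m / 2) = sqrt (t ^ m)"
    using assms by (simp add: powr_half_sqrt[symmetric] powr_powr flip: powr_realpow)
  finally show ?thesis
    using assms by (simp add: powr_half_sqrt real_sqrt_divide algebra_simps)
qed

text \<open>With \<open>y = x / (x + 1)\<close> one has \<open>y \<le> sqrt y < 1\<close>, so
  \<open>1 - sqrt y\<close> is positive and at most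
  \<open>1 - y = 1 / (x + 1) \<le> 1 / x\<close>.\<close>

lemma one_minus_sqrt_frac:
  fixes x :: real
  assumes "0 < x"
  shows "0 < 1 - sqrt (x / (x + 1))" "1 - sqrt (x / (x + 1)) \<le> 1" "1 - sqrt (x / (x + 1)) \<le> 1 / x"
proof -
  define y where "y = x / (x + 1)"
  have y: "0 \<le> y" "y < 1" "1 - y \<le> 1 / x"
    using assms by (auto simp: y_def field_simps)
  have "sqrt y < 1" using y by simp
  moreover have "y \<le> sqrt y"
    using y by (intro real_le_rsqrt) (simp add: power2_eq_square mult_left_le)
  ultimately show "0 < 1 - sqrt (x / (x + 1))" "1 - sqrt (x / (x + 1)) \<le> 1"
      "1 - sqrt (x / (x + 1)) \<le> 1 / x"
    using y by (auto simp flip: y_def)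
qed

lemma set_integrable_powr_0_1:
  assumes "-1 < (p::real)"
  shows "set_integrable lborel {0<..1} (\<lambda>t. t powr p)"
proof -
  have "(\<lambda>t::real. t powr p) absolutely_integrable_on {0..1}"
    using assms integrable_on_powr_from_0[of p 1] by (intro nonnegative_absolutely_integrable_1) auto
  \<comment> \<open>Absolute integrability refers to the completed measure \<open>lebesgue\<close>;
    for a Borel measurable integrand it transfers to \<open>lborel\<close>.\<close>
  then have "set_integrable lborel {0..1} (\<lambda>t::real. t powr p)"
    unfolding set_integrable_def by (subst (asm) integrable_completion) auto
  then show ?thesis by (rule set_integrable_subset) auto
qed

lemma set_integrable_powr_1_inf:
  assumes "p < (-1::real)"
  shows "set_integrable lborel {1<..} (\<lambda>t. t powr p)"
proof -
  have "(\<lambda>t::real. t powr p) absolutely_integrable_on {1..}"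
    using assms has_integral_powr_to_inf[of p 1] by (intro nonnegative_absolutely_integrable_1) auto
  then have "set_integrable lborel {1..} (\<lambda>t::real. t powr p)"
    unfolding set_integrable_def by (subst (asm) integrable_completion) auto
  then show ?thesis by (rule set_integrable_subset) auto
qed

lemma K_integral_1_nonzero:
  assumes "3 \<le> m" "1 \<le> j" "real j \<le> (real m + 1) / 2"
  shows "K_integral m j 1 \<noteq> 0"
proof
  assume zero: "K_integral m j 1 = 0"
  define f where "f t = t powr (real m / 2 - real j) * (1 - sqrt (t ^ m / (t ^ m + 1)))" for t :: real
  have pos: "0 < f t" if "0 < t" for t
    unfolding f_def using that one_minus_sqrt_frac(1)[of "t ^ m"] by simp
  \<comment> \<open>Integrability is essential here: a function that is not integrable has integral
    0 by default, so the sign alone would not exclude \<open>zero\<close>. Near 0 the bracket is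
    bounded by 1, and \<open>j \<le> (m+1)/2\<close> keeps the exponent m/2 - j at or above
    -1/2.\<close>
  have int_0_1: "set_integrable lborel {0<..1} f"
  proof (rule set_integrable_bound[OF set_integrable_powr_0_1[of "real m / 2 - real j"]])
    show "AE t in lborel. t \<in> {0<..1} \<longrightarrow> norm (f t) \<le> norm (t powr (real m / 2 - real j))"
    proof (intro AE_I2 impI)
      fix t :: real assume "t \<in> {0<..1}"
      then show "norm (f t) \<le> norm (t powr (real m / 2 - real j))"
        using one_minus_sqrt_frac(1,2)[of "t ^ m"] by (simp add: f_def abs_mult mult_left_le)
    qed
  qed (use assms in \<open>auto simp: set_borel_measurable_def f_def\<close>)
  \<comment> \<open>Here the bound \<open>1 / x\<close> at \<open>x = t ^ m\<close> lowers the
    exponent by m, to -m/2 - j.\<close>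
  have int_1_inf: "set_integrable lborel {1<..} f"
  proof (rule set_integrable_bound[OF set_integrable_powr_1_inf[of "- real m / 2 - real j"]])
    show "AE t in lborel. t \<in> {1<..} \<longrightarrow> norm (f t) \<le> norm (t powr (- real m / 2 - real j))"
    proof (intro AE_I2 impI)
      fix t :: real assume t: "t \<in> {1<..}"
      have "norm (f t) \<le> t powr (real m / 2 - real j) * (1 / t ^ m)"
      proof -
        have "norm (f t) = f t" using pos[of t] t by simp
        also have "\<dots> \<le> t powr (real m / 2 - real j) * (1 / t ^ m)"
          unfolding f_def using t one_minus_sqrt_frac(3)[of "t ^ m"] by (intro mult_left_mono) auto
        finally show ?thesis .
      qed
      also have "\<dots> = t powr (real m / 2 - real j - real m)"
        using t powr_diff[of t "real m / 2 - real j" "real m"] by (simp add: powr_realpow)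
      finally show "norm (f t) \<le> norm (t powr (- real m / 2 - real j))"
        by (simp add: field_simps)
    qed
  qed (use assms in \<open>auto simp: set_borel_measurable_def f_def\<close>)
  have "set_integrable lborel ({0<..1} \<union> {1<..}) f"
    by (rule set_integrable_Un[OF int_0_1 int_1_inf]) auto
  also have "{0<..1} \<union> {1<..} = {0::real<..}" by auto
  finally have int: "set_integrable lborel {0<..} f" .
  have "K_integral m j 1 = (LBINT t:{0<..}. - f t)"
    unfolding K_integral_def f_def
    by (intro set_lebesgue_integral_cong) (auto simp: K_integral_1_integrand)
  then have "(LBINT t:{0<..}. f t) = 0" using zero set_integral_uminus[OF int] by simp
  moreover have "AE t in lborel. 0 \<le> indicator {0<..} t *\<^sub>R f t"
    using pos by (intro AE_I2) (auto simp: indicator_def less_imp_le)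
  ultimately have "AE t in lborel. indicator {0<..} t *\<^sub>R f t = 0"
    using int unfolding set_integrable_def set_lebesgue_integral_def
    by (subst (asm) integral_nonneg_eq_0_iff_AE) auto
  \<comment> \<open>\<open>f\<close> has no zero on the positive axis, so vanishing almost
    everywhere would make the unit interval a null set.\<close>
  then have "AE t in lborel. t \<notin> {0::real<..<1}"
    by eventually_elim (use pos in \<open>force simp: indicator_def split: if_splits\<close>)
  then have "emeasure lborel {0::real<..<1} = 0"
    by (subst (asm) AE_iff_measurable[of "{0<..<1}"]) auto
  then show False by simp
qed

section \<open>The coefficients d_j and e_j\<close>

lemma linear_in_last_d_coeff:
  assumes "3 \<le> m" "1 \<le> j" "real j \<le> (real m + 2) / 2"
  shows "linear_in_last j (d_coeff m j)"
proof -
  \<comment> \<open>For m = 3 the real bound 5/2 exceeds m - 1 = 2, so the integrality of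
    \<open>j\<close> has to be used.\<close>
  have jm: "j \<le> m - 1"
  proof -
    have "real (2 * j) \<le> real (m + 2)" using assms(3) by simp
    then have "2 * j \<le> m + 2" by (simp only: of_nat_le_iff)
    then show ?thesis using assms(1) by linarith
  qed
  show ?thesis
  proof (cases "real j \<le> (real m + 1) / 2")
    case True
    define c where "c = complex_of_real (cos ((real j - 1) * pi / real m))"
    \<comment> \<open>From 2(j - 1) <= m - 1 < m the angle stays below a right angle, so the cosine
      factor cannot vanish.\<close>
    have "(real j - 1) * pi / real m < pi / 2"
    proof -
      have "(real j - 1) * 2 < real m" using True by simp
      then have "(real j - 1) * 2 * pi < real m * pi" by simp
      then show ?thesis using assms(1) by (simp add: field_simps)
    qed
    moreover have "0 \<le> (real j - 1) * pi / real m" using assms(2) by simp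
    ultimately have "0 < cos ((real j - 1) * pi / real m)"
      using pi_gt_zero by (intro cos_gt_zero_pi) linarith+
    then have "c \<noteq> 0" by (simp add: c_def)
    moreover have "linear_in_last j
        (\<lambda>a. \<Sum>k=1..j. b_coeff m j k a * complex_of_real (K_integral m j k))"
      using K_integral_1_nonzero[OF assms(1,2) True]
      by (intro linear_in_last_sum_b_coeff assms(2) jm) simp
    ultimately have "linear_in_last j
        (\<lambda>a. c * (\<Sum>k=1..j. b_coeff m j k a * complex_of_real (K_integral m j k)) + 0)"
      by (intro linear_in_last_scale_add) auto
    moreover have "d_coeff m j =
        (\<lambda>a. c * (\<Sum>k=1..j. b_coeff m j k a * complex_of_real (K_integral m j k)) + 0)"
      using True assms(2) by (auto simp: d_coeff_def K_coeff_def c_def)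
    ultimately show ?thesis by simp
  next
    case False
    then have "real (m + 1) < real (2 * j)" "real (2 * j) \<le> real (m + 2)" using assms(3) by auto
    \<comment> \<open>The integer \<open>2 * j\<close> lies above m + 1 and is at most m + 2. Hence
      m is even and the \<open>nu\<close> branch applies; the default value 0 of
      \<open>d_coeff\<close> is never reached.\<close>
    then have j: "2 * j = m + 2" unfolding of_nat_le_iff of_nat_less_iff by linarith
    then have m: "even m" "m div 2 + 1 = j" by presburger+
    define c where "c = - (complex_of_real pi / of_nat m)"
    have "linear_in_last j (\<lambda>a. c * (\<Sum>k=1..j. b_coeff m j k a * 1) + 0)"
      using assms(1) by (intro linear_in_last_scale_add linear_in_last_sum_b_coeff assms(2) jm)
        (auto simp: c_def)
    moreover have "real j = (real m + 2) / 2" using arg_cong[OF j, of real] by simp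
    then have "d_coeff m j = (\<lambda>a. c * (\<Sum>k=1..j. b_coeff m j k a * 1) + 0)"
      using False m by (auto simp: d_coeff_def nu_def c_def)
    ultimately show ?thesis by simp
  qed
qed

text \<open>At j = 0 the cosine factor is cos(-pi/m) = cos(pi/m), which cancels the one in the
  denominator of \<open>K_coeff m 0\<close>. As d_0 does not depend on \<open>a\<close>, dividing by
  it keeps polynomials polynomial.\<close>

lemma d_coeff_0:
  assumes "3 \<le> m"
  shows "d_coeff m 0 a = complex_of_real (Beta (1/2) (1 + 1 / real m) / 2)"
proof -
  have "0 < cos (pi / real m)"
    using assms by (intro cos_gt_zero) (auto simp: field_simps)
  then have "cos (pi / real m) \<noteq> 0" by simp
  then show ?thesis
    by (simp add: d_coeff_def K_coeff_def)
qed

lemma linear_in_last_e_coeff: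
  assumes "3 \<le> m" "1 \<le> j" "real j \<le> (real m + 2) / 2"
  shows "linear_in_last j (e_coeff m j)"
  using assms(2,3)
proof (induction j rule: less_induct)
  case (less j)
  define D :: complex where "D = complex_of_real (Beta (1/2) (1 + 1 / real m) / 2)"
  have D: "d_coeff m 0 a = D" for a by (simp add: D_def d_coeff_0[OF assms(1)])
  \<comment> \<open>Were d_0 zero, division by it would give 0 and erase the term with d_j;
    positivity of the Gamma function excludes this.\<close>
  have "0 < Beta (1/2) (1 + 1 / real m)"
    unfolding Beta_def by (intro divide_pos_pos mult_pos_pos Gamma_real_pos) (auto intro: add_pos_nonneg)
  then have D_nz: "D \<noteq> 0" by (simp add: D_def)
  define C :: complex where "C = - (2 * of_nat m / (of_nat m + 2))"
  have "of_nat m + 2 \<noteq> (0::complex)"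
    using of_nat_neq_0[of "m + 1", where 'a = complex] by (simp add: add.commute)
  then have C_nz: "C \<noteq> 0" using assms(1) by (auto simp: C_def)
  \<comment> \<open>The guarded recursion is used rather than \<open>e_coeff_rec\<close>: each
    factor is then a polynomial in the earlier variables, by induction for \<open>l < j\<close> and
    as the constant 0 otherwise, whatever the multi-index.\<close>
  have e_guard: "polynomial_in {1..<j} (\<lambda>a. mi_power m (\<lambda>l. if l < j then e_coeff m l a else 0) \<xi>)"
    for \<xi>
  proof (rule polynomial_in_mi_power)
    fix l assume l: "l \<in> {1..m-1}"
    show "polynomial_in {1..<j} (\<lambda>a. if l < j then e_coeff m l a else 0)"
    proof (cases "l < j")
      case True
      have "polynomial_in {1..l} (e_coeff m l)"
        using l True less by (intro linear_in_last_polynomial_in less.IH) auto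
      then have "polynomial_in {1..<j} (e_coeff m l)"
        by (rule polynomial_in_mono) (use True in auto)
      then show ?thesis using True by simp
    qed auto
  qed
  have d: "polynomial_in {1..<j} (d_coeff m r)" if "r \<in> {1..j-1}" for r
  proof (rule polynomial_in_mono)
    show "polynomial_in {1..r} (d_coeff m r)"
      using that less.prems assms(1)
      by (intro linear_in_last_polynomial_in linear_in_last_d_coeff) auto
  qed (use that in auto)
  \<comment> \<open>Everything in the recursion except the term with d_j, which is the only source
    of \<open>a j\<close>.\<close>
  define g where "g a = C *
       ((\<Sum>\<xi> | \<xi> \<in> multi_indices m \<and> 2 \<le> mi_abs m \<xi> \<and> mi_weight m \<xi> = j.
            ((1/2 + 1 / of_nat m) gchoose mi_abs m \<xi>) * (fact (mi_abs m \<xi>) / mi_fact m \<xi>)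
            * mi_power m (\<lambda>l. if l < j then e_coeff m l a else 0) \<xi>)
       + (\<Sum>r=1..j-1. d_coeff m r a / D *
            (\<Sum>\<xi> | \<xi> \<in> multi_indices m \<and> mi_weight m \<xi> = j - r.
               ((1/2 + (1 - of_nat r) / of_nat m) gchoose mi_abs m \<xi>)
               * (fact (mi_abs m \<xi>) / mi_fact m \<xi>)
               * mi_power m (\<lambda>l. if l < j then e_coeff m l a else 0) \<xi>)))" for a
  have "polynomial_in {1..<j} g"
    unfolding g_def[abs_def]
    by (intro polynomial_in_mult polynomial_in_const polynomial_in_add polynomial_in_sum
        polynomial_in_divide_const e_guard d)
  then have "linear_in_last j (\<lambda>a. C / D * d_coeff m j a + g a)"
    using C_nz D_nz less.prems assms(1) by (intro linear_in_last_scale_add linear_in_last_d_coeff) auto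
  moreover have "e_coeff m j = (\<lambda>a. C / D * d_coeff m j a + g a)"
  proof
    fix a show "e_coeff m j a = C / D * d_coeff m j a + g a"
      using less.prems(1) unfolding g_def
      by (subst e_coeff.simps) (simp only: D C_def[symmetric], simp add: distrib_left add.assoc)
  qed
  ultimately show ?case by simp
qed

theorem corollary1p6:
  fixes m j :: nat
  assumes "3 \<le> m" and "1 \<le> j" and "real j \<le> (real m + 2) / 2"
  shows "(polynomial_in {1..j} (d_coeff m j) \<and> polynomial_in {1..j} (e_coeff m j) \<and>
          nonconstant_linear_in j (d_coeff m j) \<and> nonconstant_linear_in j (e_coeff m j)) \<and>
         (independent_of {j+1..m-1} (d_coeff m j) \<and> independent_of {j+1..m-1} (e_coeff m j))"
proof -
  have "polynomial_in {1..j} f \<and> nonconstant_linear_in j f \<and> independent_of {j+1..m-1} f"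
    if "linear_in_last j f" for f
  proof (intro conjI)
    show poly: "polynomial_in {1..j} f"
      using that assms(2) by (rule linear_in_last_polynomial_in)
    show "nonconstant_linear_in j f"
      using that by (rule linear_in_last_nonconstant_linear_in)
    show "independent_of {j+1..m-1} f"
      by (rule polynomial_in_imp_independent_of[OF poly]) auto
  qed
  then show ?thesis
    using linear_in_last_d_coeff[OF assms] linear_in_last_e_coeff[OF assms] by blast
qed

end
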